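(* Let $A=(a_1\,\cdots\,a_n)\in\mathbb{Z}^{d\times n}$ be a matrix with columns $a_1,\dots,a_n$ such that $\sum_{j=1}^n\mathbb{Z}a_j=\mathbb{Z}^d$, and let $T$ be a regular triangulation of $A$ that refines $\Gamma_A$. The following conditions are equivalent: (i) $\omega_0$ belongs to the closure of the cone $C(T)$; (ii) $T$ refines the polyhedral subdivision $T_0$; (iii) $U_T(R)\cap\{x_n=0\}\neq\emptyset$ for all $R>0$; (iv) $U_T(R)\cap\{x_n=0\}\neq\emptyset$ for some $R>0$.
   Context: For $\tau\subseteq\{1,\dots,n\}$ write $\operatorname{pos}(\tau)=\sum_{i\in\tau}\mathbb{R}_{\ge0}a_i$, and $\operatorname{pos}(A)=\operatorname{pos}(\{1,\dots,n\})$. Subsets $\tau$ are identified with the corresponding sets of columns of $A$ when convenient. Regular subdivisions. A vector $\omega\in\mathbb{R}^n$ defines a polyhedral complex $T_\omega$ on $\{1,\dots,n\}$: $\tau\in T_\omega$ iff there is $\mathbf{c}\in\mathbb{R}^d$ with $\langle\mathbf{c},a_j\rangle=\omega_j$ for all $j\in\tau$ and $\langle\mathbf{c},a_j\rangle<\omega_j$ for all $j\notin\tau$. If $\operatorname{pos}(A)=\bigcup_{\tau\in T_\omega}\operatorname{pos}(\tau)$ (which always holds if all $\omega_i>0$), $\omega$ is called a weight vector and $T_\omega$ a regular subdivision of $A$. If moreover $T_\omega$ is an abstract simplicial complex, $T_\omega$ is called a regular triangulation of $A$. A subdivision $T$ refines $T'$ if every element of $T$ is contained in some element of $T'$. For a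 regular subdivision $T$, $C(T)=\{\omega\in\mathbb{R}^n: T_\omega=T\}$, a convex polyhedral cone. $\Gamma_A:=T_{(1,\dots,1)}$ (its maximal cells are the facets of $\Delta_A=\operatorname{conv}(\{\mathbf{0},a_1,\dots,a_n\})$ not containing the origin). $\omega_0=\omega_0(\varepsilon):=(1,\dots,1)+\varepsilon(0,\dots,0,1)$, with $\varepsilon>0$ small enough that $T_{\omega_0(\varepsilon')}=T_{\omega_0(\varepsilon)}$ for all $\varepsilon'\in(0,\varepsilon)$; $T_0:=T_{\omega_0}$. Open sets. A simplex is a subset $\sigma\subseteq\{1,\dots,n\}$ such that the columns of the submatrix $A_\sigma=(a_i)_{i\in\sigma}$ form a basis of $\mathbb{R}^d$. For $b\in\mathbb{R}^d$ let $|b|$ be the sum of its coordinates. For a simplex $\sigma$ and $R>0$, $$U_\sigma(R)=\{x\in\mathbb{C}^n:\ |x_j|<R\,|x_\sigma^{A_\sigma^{-1}a_j}|\ \text{ for all } j\notin\sigma \text{ with } |A_\sigma^{-1}a_j|=1\},$$ where $x_\sigma=(x_i)_{i\in\sigma}$ and $|x_\sigma^{b}|=\prod_{i\in\sigma}|x_i|^{b_i}$. When some coordinates $x_i$ vanish, the inequality is understood after moving factors with negative exponents to the left-hand side, i.e. as $|x_j|\prod_{i\in\sigma,\,b_i<0}|x_i|^{-b_i}<R\prod_{i\in\sigma,\,b_i>0}|x_i|^{b_i}$ with $b=A_\sigma^{-1}a_j$. For a regular triangulation $T$, $U_T(R)=\bigcap_\sigma U_\sigma(R)$ over the maximal simplices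 $\sigma$ of $T$. *)

theory Defs
  imports "HOL-Analysis.Analysis"
begin

text \<open>
  The columns of a \<open>d \<times> n\<close> matrix are indexed by a type \<open>'n\<close> of class \<open>finite\<close> and, where the last
  index \<open>n\<close> matters, \<open>linorder\<close>; such a type is order isomorphic to \<open>{1..n}\<close>.
\<close>

definition acol :: "int^'n^'d \<Rightarrow> 'n \<Rightarrow> real^'d"
  where "acol A j = (\<chi> i. real_of_int (A $ i $ j))"

definition pos :: "int^'n^'d \<Rightarrow> 'n set \<Rightarrow> (real^'d) set"
  where "pos A \<tau> = {\<Sum>i\<in>\<tau>. t i *\<^sub>R acol A i |t. \<forall>i\<in>\<tau>. 0 \<le> t i}"

definition subdiv :: "int^'n^'d \<Rightarrow> real^'n \<Rightarrow> 'n set set"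
  where "subdiv A \<omega> =
    {\<tau>. \<exists>c. (\<forall>j\<in>\<tau>. c \<bullet> acol A j = \<omega> $ j) \<and> (\<forall>j. j \<notin> \<tau> \<longrightarrow> c \<bullet> acol A j < \<omega> $ j)}"

definition weight_vector :: "int^'n^'d \<Rightarrow> real^'n \<Rightarrow> bool"
  where "weight_vector A \<omega> \<longleftrightarrow> pos A UNIV = (\<Union>\<tau>\<in>subdiv A \<omega>. pos A \<tau>)"

definition simplicial_complex :: "'n set set \<Rightarrow> bool"
  where "simplicial_complex T \<longleftrightarrow> (\<forall>\<tau>\<in>T. \<forall>\<rho>. \<rho> \<subseteq> \<tau> \<longrightarrow> \<rho> \<in> T)"

definition regular_triangulation :: "int^'n^'d \<Rightarrow> 'n set set \<Rightarrow> bool"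
  where "regular_triangulation A T \<longleftrightarrow>
    (\<exists>\<omega>. weight_vector A \<omega> \<and> T = subdiv A \<omega>) \<and> simplicial_complex T"

definition subdiv_refines :: "'n set set \<Rightarrow> 'n set set \<Rightarrow> bool"
  where "subdiv_refines T T' \<longleftrightarrow> (\<forall>\<tau>\<in>T. \<exists>\<tau>'\<in>T'. \<tau> \<subseteq> \<tau>')"

definition weight_cone :: "int^'n^'d \<Rightarrow> 'n set set \<Rightarrow> (real^'n) set"
  where "weight_cone A T = {\<omega>. subdiv A \<omega> = T}"

definition Gamma_subdiv :: "int^'n^'d \<Rightarrow> 'n set set"
  where "Gamma_subdiv A = subdiv A (\<chi> j. 1)"

definition last_index :: "'n::{finite,linorder}"
  where "last_index = Max UNIV"

definition omega0 :: "real \<Rightarrow> real^('n::{finite,linorder})"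
  where "omega0 \<epsilon> = (\<chi> j. 1) + \<epsilon> *\<^sub>R axis last_index 1"

definition simplex_of :: "int^'n^'d \<Rightarrow> 'n set \<Rightarrow> bool"
  where "simplex_of A \<sigma> \<longleftrightarrow>
    inj_on (acol A) \<sigma> \<and> independent (acol A ` \<sigma>) \<and> span (acol A ` \<sigma>) = UNIV"

text \<open>
  For a simplex \<open>\<sigma>\<close> and \<open>i \<in> \<sigma>\<close>, \<open>coord A \<sigma> v i\<close> is the entry with index \<open>i\<close> of \<open>A\<^sub>\<sigma>\<^sup>-\<^sup>1 v\<close>: these entries
  are the coordinates of \<open>v\<close> in the basis given by the columns with indices in \<open>\<sigma>\<close>
  (lemmas \<open>coord_sum\<close> and \<open>coord_unique\<close>).
\<close>

definition coord :: "int^'n^'d \<Rightarrow> 'n set \<Rightarrow> real^'d \<Rightarrow> 'n \<Rightarrow> real"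
  where "coord A \<sigma> v i = representation (acol A ` \<sigma>) v (acol A i)"

lemma coord_sum:
  fixes A :: "int^'n^'d"
  assumes "simplex_of A \<sigma>"
  shows "(\<Sum>i\<in>\<sigma>. coord A \<sigma> v i *\<^sub>R acol A i) = v"
proof -
  have "(\<Sum>b\<in>acol A ` \<sigma>. representation (acol A ` \<sigma>) v b *\<^sub>R b) = v"
    using assms by (intro real_vector.sum_representation_eq) (auto simp: simplex_of_def)
  then show ?thesis
    using assms by (simp add: simplex_of_def coord_def sum.reindex o_def)
qed

lemma coord_unique:
  fixes A :: "int^'n^'d"
  assumes \<sigma>: "simplex_of A \<sigma>" and v: "(\<Sum>i\<in>\<sigma>. y i *\<^sub>R acol A i) = v" and i: "i \<in> \<sigma>"
  shows "y i = coord A \<sigma> v i"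
proof -
  have inj: "inj_on (acol A) \<sigma>" and ind: "independent (acol A ` \<sigma>)"
    using \<sigma> by (auto simp: simplex_of_def)
  define u where "u b = y (the_inv_into \<sigma> (acol A) b) - coord A \<sigma> v (the_inv_into \<sigma> (acol A) b)" for b
  have u: "u (acol A k) = y k - coord A \<sigma> v k" if "k \<in> \<sigma>" for k
    using that inj by (simp add: u_def the_inv_into_f_f)
  have "(\<Sum>b\<in>acol A ` \<sigma>. u b *\<^sub>R b) = (\<Sum>k\<in>\<sigma>. (y k - coord A \<sigma> v k) *\<^sub>R acol A k)"
    using inj by (simp add: sum.reindex u)
  also have "\<dots> = 0"
    using v coord_sum[OF \<sigma>] by (simp add: scaleR_diff_left sum_subtractf)
  finally have "u (acol A i) = 0"
    using independentD[OF ind, of "acol A ` \<sigma>" u "acol A i"] i by auto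
  then show ?thesis using u[OF i] by simp
qed

text \<open>
  The inequality \<open>|x\<^sub>j| < R |x\<^sub>\<sigma>\<^sup>b|\<close> with \<open>b = A\<^sub>\<sigma>\<^sup>-\<^sup>1 a\<^sub>j\<close> is stated with the factors of negative exponent
  moved to the left-hand side, which is its meaning when some \<open>x\<^sub>i\<close> vanish; lemma
  \<open>U_simplex_nonvanishing\<close> gives the original form.
\<close>

definition U_simplex :: "int^'n^'d \<Rightarrow> 'n set \<Rightarrow> real \<Rightarrow> (complex^'n) set"
  where "U_simplex A \<sigma> R = {x. \<forall>j. j \<notin> \<sigma> \<and> (\<Sum>i\<in>\<sigma>. coord A \<sigma> (acol A j) i) = 1 \<longrightarrow>
    (let b = coord A \<sigma> (acol A j) in
      norm (x $ j) * (\<Prod>i | i \<in> \<sigma> \<and> b i < 0. norm (x $ i) powr (- b i))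
        < R * (\<Prod>i | i \<in> \<sigma> \<and> b i > 0. norm (x $ i) powr b i))}"

lemma U_simplex_nonvanishing:
  fixes A :: "int^'n^'d" and x :: "complex^'n"
  assumes "\<forall>i\<in>\<sigma>. x $ i \<noteq> 0"
  shows "x \<in> U_simplex A \<sigma> R \<longleftrightarrow>
    (\<forall>j. j \<notin> \<sigma> \<and> (\<Sum>i\<in>\<sigma>. coord A \<sigma> (acol A j) i) = 1 \<longrightarrow>
      norm (x $ j) < R * (\<Prod>i\<in>\<sigma>. norm (x $ i) powr coord A \<sigma> (acol A j) i))"
proof -
  have "norm (x $ j) * (\<Prod>i | i \<in> \<sigma> \<and> b i < 0. norm (x $ i) powr (- b i))
      < R * (\<Prod>i | i \<in> \<sigma> \<and> b i > 0. norm (x $ i) powr b i) \<longleftrightarrow>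
    norm (x $ j) < R * (\<Prod>i\<in>\<sigma>. norm (x $ i) powr b i)" for b :: "'n \<Rightarrow> real" and j
  proof -
    let ?N = "{i. i \<in> \<sigma> \<and> b i < 0}" and ?P = "{i. i \<in> \<sigma> \<and> b i > 0}" and ?Z = "{i. i \<in> \<sigma> \<and> b i = 0}"
    let ?f = "\<lambda>i. norm (x $ i) powr b i"
    have \<sigma>: "\<sigma> = ?N \<union> (?P \<union> ?Z)" by auto
    have "prod ?f \<sigma> = prod ?f (?N \<union> (?P \<union> ?Z))"
      using \<sigma> by (rule arg_cong)
    also have "\<dots> = prod ?f ?N * (prod ?f ?P * prod ?f ?Z)"
      by (subst prod.union_disjoint, simp, simp, fastforce, subst prod.union_disjoint) auto
    also have "prod ?f ?Z = 1"
      using assms by (intro prod.neutral) auto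
    finally have split: "prod ?f \<sigma> = prod ?f ?N * prod ?f ?P" by simp
    have inv: "(\<Prod>i\<in>?N. norm (x $ i) powr (- b i)) = inverse (prod ?f ?N)"
      by (simp add: powr_minus prod_inversef[symmetric] o_def)
    have "prod ?f ?N > 0"
      using assms by (intro prod_pos) auto
    then show ?thesis
      unfolding split inv by (simp add: field_simps)
  qed
  then show ?thesis
    by (simp add: U_simplex_def Let_def)
qed

definition maximal_cells :: "'n set set \<Rightarrow> 'n set set"
  where "maximal_cells T = {\<sigma>\<in>T. \<forall>\<tau>\<in>T. \<sigma> \<subseteq> \<tau> \<longrightarrow> \<tau> = \<sigma>}"

text \<open>
  If the columns of \<open>A\<close> span \<open>\<real>\<^sup>d\<close>, every maximal cell of a regular triangulation is a simplex.
\<close>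

definition U_triang :: "int^'n^'d \<Rightarrow> 'n set set \<Rightarrow> real \<Rightarrow> (complex^'n) set"
  where "U_triang A T R = (\<Inter>\<sigma>\<in>maximal_cells T. U_simplex A \<sigma> R)"

end

theory Submission
  imports Defs
begin

text \<open>
  For a simplex \<open>\<sigma>\<close> write \<open>b = A\<^sub>\<sigma>\<^sup>-\<^sup>1 a\<^sub>j\<close>. Then \<open>\<sigma>\<close> lies in a cell of \<open>T\<^sub>\<omega>\<close> iff
  \<open>\<Sum>i\<in>\<sigma>. b\<^sub>i \<omega>\<^sub>i \<le> \<omega>\<^sub>j\<close> for all \<open>j\<close>, and these conditions are closed in \<open>\<omega>\<close>; conversely, if \<open>T = T\<^sub>\<omega>\<close>
  refines \<open>T\<^sub>0\<close>, then \<open>\<omega>\<^sub>0 + t \<omega> \<in> C(T)\<close> for all \<open>t > 0\<close>. This is the equivalence of (i) and (ii).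
  Since \<open>T\<close> refines \<open>\<Gamma>\<^sub>A\<close>, we have \<open>|b| \<le> 1\<close>, so that for small \<open>\<epsilon>\<close> the conditions for \<open>\<omega>\<^sub>0\<close> say exactly that
  \<open>b\<^sub>n \<le> 0\<close> whenever \<open>n \<in> \<sigma>\<close>, \<open>j \<notin> \<sigma>\<close> and \<open>|b| = 1\<close>. This is forced by a point of \<open>U\<^sub>T(R)\<close> with
  \<open>x\<^sub>n = 0\<close>, because the right-hand side of the inequality for \<open>j\<close> must not vanish. In turn it makes
  \<open>x\<^sub>j = s\<^bsup>\<omega>\<^sub>j\<^esup>\<close> for \<open>j \<noteq> n\<close>, \<open>x\<^sub>n = 0\<close> a point of \<open>U\<^sub>T(R)\<close> for small \<open>s > 0\<close>.
\<close>

section \<open>Cells, maximal cells and refinement\<close>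

text \<open>The set of all indices where \<open>c\<close> is tight is itself a cell and contains
  \<open>\<tau>\<close>, so lying in a cell takes only weak inequalities.\<close>

lemma subset_cell_iff:
  fixes A :: "int^'n^'d"
  shows "(\<exists>\<tau>'\<in>subdiv A \<omega>. \<tau> \<subseteq> \<tau>') \<longleftrightarrow>
    (\<exists>c. (\<forall>j\<in>\<tau>. c \<bullet> acol A j = \<omega> $ j) \<and> (\<forall>j. c \<bullet> acol A j \<le> \<omega> $ j))"
proof
  assume "\<exists>\<tau>'\<in>subdiv A \<omega>. \<tau> \<subseteq> \<tau>'"
  then obtain \<tau>' c where "\<tau> \<subseteq> \<tau>'" "\<forall>j\<in>\<tau>'. c \<bullet> acol A j = \<omega> $ j"
    "\<forall>j. j \<notin> \<tau>' \<longrightarrow> c \<bullet> acol A j < \<omega> $ j"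
    by (auto simp: subdiv_def)
  then show "\<exists>c. (\<forall>j\<in>\<tau>. c \<bullet> acol A j = \<omega> $ j) \<and> (\<forall>j. c \<bullet> acol A j \<le> \<omega> $ j)"
    by (intro exI[of _ c]) (metis in_mono less_imp_le order_refl)
next
  assume "\<exists>c. (\<forall>j\<in>\<tau>. c \<bullet> acol A j = \<omega> $ j) \<and> (\<forall>j. c \<bullet> acol A j \<le> \<omega> $ j)"
  then obtain c where c: "\<forall>j\<in>\<tau>. c \<bullet> acol A j = \<omega> $ j" "\<forall>j. c \<bullet> acol A j \<le> \<omega> $ j"
    by blast
  then have "{j. c \<bullet> acol A j = \<omega> $ j} \<in> subdiv A \<omega>"
    by (auto simp: subdiv_def order_less_le intro!: exI[of _ c])
  moreover have "\<tau> \<subseteq> {j. c \<bullet> acol A j = \<omega> $ j}" using c(1) by blast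
  ultimately show "\<exists>\<tau>'\<in>subdiv A \<omega>. \<tau> \<subseteq> \<tau>'" by (rule rev_bexI)
qed

lemma maximal_cellsD: "\<sigma> \<in> maximal_cells T \<Longrightarrow> \<sigma> \<in> T"
  by (simp add: maximal_cells_def)

lemma subset_maximal_cell:
  fixes T :: "'n::finite set set"
  assumes "\<tau> \<in> T"
  obtains \<sigma> where "\<sigma> \<in> maximal_cells T" "\<tau> \<subseteq> \<sigma>"
proof -
  obtain \<sigma> where "\<sigma> \<in> T" "\<tau> \<subseteq> \<sigma>" "\<forall>\<rho>\<in>T. \<sigma> \<subseteq> \<rho> \<longrightarrow> \<sigma> = \<rho>"
    using finite_has_maximal2[of T \<tau>] assms by auto
  then show thesis by (intro that[of \<sigma>]) (auto simp: maximal_cells_def)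
qed

text \<open>By finiteness every cell lies in a maximal one. This reduces refinement to the maximal
  cells, where simplex coordinates will be available.\<close>

lemma subdiv_refines_iff_maximal:
  fixes T :: "'n::finite set set"
  shows "subdiv_refines T T' \<longleftrightarrow> (\<forall>\<sigma>\<in>maximal_cells T. \<exists>\<tau>'\<in>T'. \<sigma> \<subseteq> \<tau>')"
proof
  assume "subdiv_refines T T'"
  then show "\<forall>\<sigma>\<in>maximal_cells T. \<exists>\<tau>'\<in>T'. \<sigma> \<subseteq> \<tau>'"
    unfolding subdiv_refines_def using maximal_cellsD by blast
next
  assume *: "\<forall>\<sigma>\<in>maximal_cells T. \<exists>\<tau>'\<in>T'. \<sigma> \<subseteq> \<tau>'"
  show "subdiv_refines T T'"
    unfolding subdiv_refines_def
  proof
    fix \<tau> assume "\<tau> \<in> T"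
    then obtain \<sigma> where "\<sigma> \<in> maximal_cells T" "\<tau> \<subseteq> \<sigma>" by (rule subset_maximal_cell)
    with * show "\<exists>\<tau>'\<in>T'. \<tau> \<subseteq> \<tau>'" by (meson order_trans)
  qed
qed

section \<open>Maximal cells of a triangulation are simplices\<close>

text \<open>The functionals of the cells \<open>\<tau>\<close> and \<open>\<tau> - {k}\<close> agree
  on every column of \<open>\<tau>\<close> except that of \<open>k\<close>; their difference,
  applied to the relation, leaves only the term of \<open>k\<close>.\<close>

lemma simplicial_cell_independent:
  fixes A :: "int^'n^'d"
  assumes sc: "simplicial_complex (subdiv A \<omega>)" and \<tau>: "\<tau> \<in> subdiv A \<omega>"
    and 0: "(\<Sum>i\<in>\<tau>. u i *\<^sub>R acol A i) = 0" and k: "k \<in> \<tau>"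
  shows "u k = 0"
proof -
  have ev: "(\<Sum>i\<in>\<tau>. u i * (c \<bullet> acol A i)) = 0" for c
    using arg_cong[OF 0, of "\<lambda>v. c \<bullet> v"] by (simp add: inner_sum_right)
  obtain c where c: "\<forall>j\<in>\<tau>. c \<bullet> acol A j = \<omega> $ j"
    using \<tau> by (auto simp: subdiv_def)
  have "\<tau> - {k} \<in> subdiv A \<omega>"
    using sc \<tau> by (auto simp: simplicial_complex_def)
  then obtain c' where c': "\<forall>j\<in>\<tau> - {k}. c' \<bullet> acol A j = \<omega> $ j" "c' \<bullet> acol A k < \<omega> $ k"
    by (auto simp: subdiv_def)
  have "(\<Sum>i\<in>\<tau>. u i * ((c - c') \<bullet> acol A i)) = u k * ((c - c') \<bullet> acol A k)"
    using c c' k by (subst sum.remove[of _ k]) (auto simp: inner_diff_left)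
  with ev[of "c - c'"] c c' k show ?thesis
    by (auto simp: inner_diff_left)
qed

text \<open>Moving the functional of \<open>\<tau>\<close> along \<open>v\<close> keeps it tight on
  \<open>\<tau>\<close> and raises its value at \<open>k\<close>, until some further inequality
  becomes tight.\<close>

lemma extend_cell:
  fixes A :: "int^'n^'d"
  assumes \<tau>: "\<tau> \<in> subdiv A \<omega>" and v: "\<forall>j\<in>\<tau>. v \<bullet> acol A j = 0" and k: "v \<bullet> acol A k > 0"
  shows "\<exists>\<tau>'\<in>subdiv A \<omega>. \<tau> \<subset> \<tau>'"
proof -
  obtain c where c: "\<forall>j\<in>\<tau>. c \<bullet> acol A j = \<omega> $ j" "\<forall>j. j \<notin> \<tau> \<longrightarrow> c \<bullet> acol A j < \<omega> $ j"
    using \<tau> by (auto simp: subdiv_def)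
  define P where "P = {j. v \<bullet> acol A j > 0}"
  define q where "q j = (\<omega> $ j - c \<bullet> acol A j) / (v \<bullet> acol A j)" for j
  \<comment> \<open>The largest step that violates no inequality; only the columns in
    \<open>P\<close> limit it.\<close>
  define t where "t = Min (q ` P)"
  have P: "finite P" "P \<noteq> {}" "P \<inter> \<tau> = {}" using k v by (auto simp: P_def)
  then have "t \<in> q ` P" unfolding t_def by (intro Min_in) auto
  then obtain m where m: "m \<in> P" "t = q m" by blast
  have tq: "t \<le> q j" if "j \<in> P" for j using that P by (auto simp: t_def)
  have t0: "t > 0" using m c P by (auto simp: q_def P_def)
  have le: "(c + t *\<^sub>R v) \<bullet> acol A j \<le> \<omega> $ j" for j
  proof (cases "j \<in> P")
    case True
    then show ?thesis using tq[of j] by (auto simp: q_def P_def field_simps inner_add_left)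
  next
    case False
    then have "t * (v \<bullet> acol A j) \<le> 0" using t0 by (auto simp: P_def mult_le_0_iff)
    moreover have "c \<bullet> acol A j \<le> \<omega> $ j" using c by (cases "j \<in> \<tau>") (auto simp: less_imp_le)
    ultimately show ?thesis by (auto simp: inner_add_left)
  qed
  have "(c + t *\<^sub>R v) \<bullet> acol A j = \<omega> $ j" if "j \<in> insert m \<tau>" for j
    using that m c v by (auto simp: inner_add_left q_def P_def)
  then have "\<exists>\<tau>'\<in>subdiv A \<omega>. insert m \<tau> \<subseteq> \<tau>'"
    using le by (subst subset_cell_iff) blast
  with m P show ?thesis by blast
qed

lemma ex_not_orthogonal_if_spanning:
  fixes a :: "'i \<Rightarrow> 'v::euclidean_space"
  assumes "span (range a) = UNIV" and "v \<noteq> 0"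
  shows "\<exists>k. v \<bullet> a k \<noteq> 0"
proof (rule ccontr)
  assume "\<not> (\<exists>k. v \<bullet> a k \<noteq> 0)"
  then have "range a \<subseteq> {x. v \<bullet> x = 0}" by blast
  then have "span (range a) \<subseteq> {x. v \<bullet> x = 0}"
    by (rule span_minimal) (rule subspace_hyperplane)
  then have "v \<in> {x. v \<bullet> x = 0}" unfolding assms(1) by (rule subsetD) (rule UNIV_I)
  with assms(2) show False by simp
qed

text \<open>Independence comes from the simplicial property, spanning from maximality: a nonzero
  \<open>v\<close> orthogonal to the columns of \<open>\<sigma>\<close> would, up to sign, be a
  direction for extending the cell.\<close>

lemma maximal_cell_simplex:
  fixes A :: "int^'n^'d"
  assumes span: "span (range (acol A)) = UNIV"
    and sc: "simplicial_complex (subdiv A \<omega>)" and \<sigma>: "\<sigma> \<in> maximal_cells (subdiv A \<omega>)"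
  shows "simplex_of A \<sigma>"
proof -
  have max: "\<not> \<sigma> \<subset> \<tau>" if "\<tau> \<in> subdiv A \<omega>" for \<tau>
    using \<sigma> that unfolding maximal_cells_def by blast
  have \<sigma>': "\<sigma> \<in> subdiv A \<omega>"
    using \<sigma> by (rule maximal_cellsD)
  note ind = simplicial_cell_independent[OF sc \<sigma>']
  have inj: "inj_on (acol A) \<sigma>"
  proof (rule inj_onI, rule ccontr)
    fix i k assume ik: "i \<in> \<sigma>" "k \<in> \<sigma>" "acol A i = acol A k" "i \<noteq> k"
    \<comment> \<open>\<open>independent\<close> speaks of the set of columns, so repeated columns
      are excluded separately, by the relation \<open>acol A i - acol A k = 0\<close>.\<close>
    define u where "u l = (if l = i then 1 else if l = k then -1 else 0 :: real)" for l
    have "(\<Sum>l\<in>\<sigma>. u l *\<^sub>R acol A l) = (\<Sum>l\<in>{i, k}. u l *\<^sub>R acol A l)"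
      using ik by (intro sum.mono_neutral_right) (auto simp: u_def)
    also have "\<dots> = 0" using ik by (simp add: u_def)
    finally show False using ind[of u i] ik by (simp add: u_def)
  qed
  have "independent (acol A ` \<sigma>)"
  proof
    assume "dependent (acol A ` \<sigma>)"
    then obtain u where u: "\<exists>v\<in>acol A ` \<sigma>. u v \<noteq> 0" "(\<Sum>v\<in>acol A ` \<sigma>. u v *\<^sub>R v) = 0"
      by (auto simp: dependent_finite)
    then have "(\<Sum>i\<in>\<sigma>. u (acol A i) *\<^sub>R acol A i) = 0"
      using inj by (simp add: sum.reindex)
    then have "u (acol A k) = 0" if "k \<in> \<sigma>" for k
      using that by (rule ind)
    with u(1) show False by blast
  qed
  moreover have "span (acol A ` \<sigma>) = UNIV"
  proof (rule ccontr)
    assume "span (acol A ` \<sigma>) \<noteq> UNIV"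
    then obtain v where v: "v \<noteq> 0" "\<forall>x\<in>span (acol A ` \<sigma>). v \<bullet> x = 0"
      using span_not_UNIV_orthogonal by blast
    obtain k where k: "v \<bullet> acol A k \<noteq> 0"
      using ex_not_orthogonal_if_spanning[OF span v(1)] by (rule exE)
    have v0: "\<forall>j\<in>\<sigma>. v \<bullet> acol A j = 0"
      using v(2) by (blast intro: span_base)
    have "\<exists>\<tau>'\<in>subdiv A \<omega>. \<sigma> \<subset> \<tau>'"
    proof (cases "v \<bullet> acol A k > 0")
      case True
      show ?thesis using extend_cell[OF \<sigma>' v0 True] .
    next
      case False
      show ?thesis
        by (rule extend_cell[OF \<sigma>', of "- v" k]) (use v0 k False in simp_all)
    qed
    then show False using max by (elim bexE) (rule notE)
  qed
  ultimately show ?thesis using inj by (simp add: simplex_of_def)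
qed

section \<open>Cells in the coordinates of a simplex\<close>

lemma inner_coord:
  fixes A :: "int^'n^'d"
  assumes "simplex_of A \<sigma>"
  shows "c \<bullet> v = (\<Sum>i\<in>\<sigma>. coord A \<sigma> v i * (c \<bullet> acol A i))"
  by (subst coord_sum[OF assms, of v, symmetric]) (simp add: inner_sum_right)

lemma coord_self:
  fixes A :: "int^'n^'d"
  assumes "simplex_of A \<sigma>" and "j \<in> \<sigma>"
  shows "(\<Sum>i\<in>\<sigma>. coord A \<sigma> (acol A j) i * w i) = w j"
proof -
  have *: "coord A \<sigma> (acol A j) i = (if i = j then 1 else 0)" if "i \<in> \<sigma>" for i
    using coord_unique[OF assms(1), of "\<lambda>i. if i = j then 1 else 0" "acol A j" i] assms(2) that
    by (simp add: if_distrib[of "\<lambda>x. x *\<^sub>R _"] cong: if_cong)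
  have "(\<Sum>i\<in>\<sigma>. coord A \<sigma> (acol A j) i * w i) = (\<Sum>i\<in>\<sigma>. if i = j then w i else 0)"
    by (intro sum.cong) (auto simp: *)
  with assms(2) show ?thesis by simp
qed

text \<open>Since the columns of \<open>\<sigma>\<close> form a basis, tightness on
  \<open>\<sigma>\<close> determines the functional; the sum on the left of the inequality is its
  value at \<open>acol A j\<close>.\<close>

lemma simplex_subset_cell_iff:
  fixes A :: "int^'n^'d"
  assumes \<sigma>: "simplex_of A \<sigma>"
  shows "(\<exists>\<tau>'\<in>subdiv A \<omega>. \<sigma> \<subseteq> \<tau>') \<longleftrightarrow>
    (\<forall>j. (\<Sum>i\<in>\<sigma>. coord A \<sigma> (acol A j) i * \<omega> $ i) \<le> \<omega> $ j)"
proof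
  assume "\<exists>\<tau>'\<in>subdiv A \<omega>. \<sigma> \<subseteq> \<tau>'"
  then obtain c where c: "\<forall>j\<in>\<sigma>. c \<bullet> acol A j = \<omega> $ j" "\<forall>j. c \<bullet> acol A j \<le> \<omega> $ j"
    by (subst (asm) subset_cell_iff) blast
  then show "\<forall>j. (\<Sum>i\<in>\<sigma>. coord A \<sigma> (acol A j) i * \<omega> $ i) \<le> \<omega> $ j"
    using inner_coord[OF \<sigma>, of c] by (metis (no_types, lifting) sum.cong)
next
  assume le: "\<forall>j. (\<Sum>i\<in>\<sigma>. coord A \<sigma> (acol A j) i * \<omega> $ i) \<le> \<omega> $ j"
  define f where "f v = (\<Sum>i\<in>\<sigma>. coord A \<sigma> v i * \<omega> $ i)" for v
  have "linear f"
    unfolding f_def coord_def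
    using \<sigma> by (intro linearI)
      (auto simp: simplex_of_def real_vector.representation_add real_vector.representation_scale
        sum.distrib sum_distrib_left algebra_simps)
  \<comment> \<open>\<open>adjoint f 1\<close> is the vector that represents the functional
    \<open>f\<close>.\<close>
  then have f: "adjoint f 1 \<bullet> v = f v" for v
    using adjoint_works[of f v 1] by (simp add: inner_commute)
  have "f (acol A j) = \<omega> $ j" if "j \<in> \<sigma>" for j
    unfolding f_def using coord_self[OF \<sigma> that] .
  then show "\<exists>\<tau>'\<in>subdiv A \<omega>. \<sigma> \<subseteq> \<tau>'"
    using le by (subst subset_cell_iff) (auto simp: f intro!: exI[of _ "adjoint f 1"] simp: f_def)
qed

text \<open>These strict gaps become the positive exponents of \<open>s\<close> when a point of
  \<open>U_triang\<close> is constructed.\<close>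

lemma simplex_cell_strict:
  fixes A :: "int^'n^'d"
  assumes \<sigma>: "simplex_of A \<sigma>" "\<sigma> \<in> subdiv A \<omega>" and "j \<notin> \<sigma>"
  shows "(\<Sum>i\<in>\<sigma>. coord A \<sigma> (acol A j) i * \<omega> $ i) < \<omega> $ j"
proof -
  obtain c where c: "\<forall>j\<in>\<sigma>. c \<bullet> acol A j = \<omega> $ j" "\<forall>j. j \<notin> \<sigma> \<longrightarrow> c \<bullet> acol A j < \<omega> $ j"
    using \<sigma> by (auto simp: subdiv_def)
  have "(\<Sum>i\<in>\<sigma>. coord A \<sigma> (acol A j) i * \<omega> $ i) = c \<bullet> acol A j"
    using c by (simp add: inner_coord[OF \<sigma>(1), of c "acol A j"])
  with c assms show ?thesis by simp
qed

lemma span_columns: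
  fixes A :: "int^'n^'d"
  assumes "range (\<lambda>z :: int^'n. \<Sum>j\<in>UNIV. z $ j *s column j A) = UNIV"
  shows "span (range (acol A)) = UNIV"
proof -
  have "axis k 1 \<in> span (range (acol A))" for k :: 'd
  proof -
    have "axis k 1 \<in> range (\<lambda>z :: int^'n. \<Sum>j\<in>UNIV. z $ j *s column j A)"
      unfolding assms by (rule UNIV_I)
    then obtain z :: "int^'n" where z: "axis k 1 = (\<Sum>j\<in>UNIV. z $ j *s column j A)"
      by (rule imageE)
    have "axis k 1 = (\<Sum>j\<in>UNIV. real_of_int (z $ j) *\<^sub>R acol A j)"
    proof (rule vec_eq_iff[THEN iffD2], rule allI)
      fix i :: 'd
      have "(axis k 1 :: real^'d) $ i = real_of_int ((axis k 1 :: int^'d) $ i)"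
        by (simp add: axis_def)
      also have "\<dots> = (\<Sum>j\<in>UNIV. real_of_int (z $ j) *\<^sub>R acol A j) $ i"
        unfolding z by (simp add: acol_def column_def)
      finally show "(axis k 1 :: real^'d) $ i = (\<Sum>j\<in>UNIV. real_of_int (z $ j) *\<^sub>R acol A j) $ i" .
    qed
    then show ?thesis by (simp add: span_sum span_scale span_base)
  qed
  then have "Basis \<subseteq> span (range (acol A))" by (auto simp: Basis_vec_def)
  then have "span Basis \<subseteq> span (range (acol A))" by (rule span_minimal) (rule subspace_span)
  then show ?thesis by auto
qed

section \<open>The closure of the weight cone\<close>

text \<open>The cells of \<open>T\<close> already cover the cone, which leaves no room for others:
  the sum of the columns of a cell \<open>\<rho>\<close> lies in \<open>pos A \<tau>\<close> for
  some \<open>\<tau> \<in> T\<close>, and evaluating the functionals of both cells there forces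
  \<open>\<rho> \<subseteq> \<tau>\<close>.\<close>

lemma subdiv_eq_if_cells_subset:
  fixes A :: "int^'n^'d"
  assumes cover: "pos A UNIV = (\<Union>\<tau>\<in>T. pos A \<tau>)" and sc: "simplicial_complex T"
    and sub: "T \<subseteq> subdiv A \<omega>"
  shows "subdiv A \<omega> = T"
proof
  show "subdiv A \<omega> \<subseteq> T"
  proof
    fix \<rho> assume "\<rho> \<in> subdiv A \<omega>"
    then obtain c where c: "\<forall>j\<in>\<rho>. c \<bullet> acol A j = \<omega> $ j" "\<forall>j. j \<notin> \<rho> \<longrightarrow> c \<bullet> acol A j < \<omega> $ j"
      by (auto simp: subdiv_def)
    \<comment> \<open>All coefficients are positive, so an index of \<open>\<rho>\<close> outside
      \<open>\<tau>\<close> makes the upper bound for \<open>e \<bullet> p\<close> strict.\<close>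
    define p where "p = (\<Sum>i\<in>\<rho>. acol A i)"
    have "p = (\<Sum>i\<in>UNIV. (if i \<in> \<rho> then 1 else 0) *\<^sub>R acol A i)"
      unfolding p_def by (rule sum.mono_neutral_cong_left) auto
    then have "p \<in> pos A UNIV"
      by (auto simp: pos_def intro!: exI[of _ "\<lambda>i. if i \<in> \<rho> then 1 else 0"])
    then obtain \<tau> where \<tau>: "\<tau> \<in> T" and "p \<in> pos A \<tau>"
      unfolding cover by blast
    then obtain s where s: "\<forall>i\<in>\<tau>. 0 \<le> s i" and p: "p = (\<Sum>i\<in>\<tau>. s i *\<^sub>R acol A i)"
      by (auto simp: pos_def)
    obtain e where e: "\<forall>j\<in>\<tau>. e \<bullet> acol A j = \<omega> $ j" "\<forall>j. j \<notin> \<tau> \<longrightarrow> e \<bullet> acol A j < \<omega> $ j"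
      using \<tau> sub by (auto simp: subdiv_def)
    have "\<rho> \<subseteq> \<tau>"
    proof (rule ccontr)
      assume "\<not> \<rho> \<subseteq> \<tau>"
      then obtain k where k: "k \<in> \<rho>" "k \<notin> \<tau>" by blast
      have "e \<bullet> p < (\<Sum>i\<in>\<rho>. \<omega> $ i)"
        unfolding p_def inner_sum_right
        using e k by (intro sum_strict_mono_ex1) (auto, metis less_imp_le order_refl)
      also have "\<dots> = c \<bullet> p"
        using c by (simp add: p_def inner_sum_right)
      also have "\<dots> \<le> (\<Sum>i\<in>\<tau>. s i * \<omega> $ i)"
        unfolding p inner_sum_right inner_scaleR_right
        using s c by (intro sum_mono mult_left_mono) (auto, metis less_imp_le order_refl)
      also have "\<dots> = e \<bullet> p"
        using e by (simp add: p inner_sum_right)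
      finally show False by simp
    qed
    with \<tau> sc show "\<rho> \<in> T" by (auto simp: simplicial_complex_def)
  qed
qed (rule sub)

text \<open>A functional \<open>c'\<close> that is tight on \<open>\<tau>\<close> and weakly
  admissible for \<open>\<omega>'\<close>, plus \<open>t\<close> times the functional of the cell
  \<open>\<tau>\<close>, is tight exactly on \<open>\<tau>\<close>. Hence all cells survive for
  \<open>\<omega>' + t *\<^sub>R \<omega>\<close>, and by covering there are no new ones.\<close>

lemma refines_imp_closure:
  fixes A :: "int^'n^'d"
  assumes w: "weight_vector A \<omega>" and sc: "simplicial_complex (subdiv A \<omega>)"
    and ref: "subdiv_refines (subdiv A \<omega>) (subdiv A \<omega>')"
  shows "\<omega>' \<in> closure (weight_cone A (subdiv A \<omega>))"
proof -
  have "subdiv A (\<omega>' + t *\<^sub>R \<omega>) = subdiv A \<omega>" if t: "t > 0" for t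
  proof (rule subdiv_eq_if_cells_subset[OF _ sc])
    show "pos A UNIV = (\<Union>\<tau>\<in>subdiv A \<omega>. pos A \<tau>)"
      using w by (simp add: weight_vector_def)
    show "subdiv A \<omega> \<subseteq> subdiv A (\<omega>' + t *\<^sub>R \<omega>)"
    proof
      fix \<tau> assume \<tau>: "\<tau> \<in> subdiv A \<omega>"
      then obtain c where c: "\<forall>j\<in>\<tau>. c \<bullet> acol A j = \<omega> $ j" "\<forall>j. j \<notin> \<tau> \<longrightarrow> c \<bullet> acol A j < \<omega> $ j"
        by (auto simp: subdiv_def)
      from \<tau> ref have "\<exists>\<tau>'\<in>subdiv A \<omega>'. \<tau> \<subseteq> \<tau>'" by (simp add: subdiv_refines_def)
      then obtain c' where c': "\<forall>j\<in>\<tau>. c' \<bullet> acol A j = \<omega>' $ j" "\<forall>j. c' \<bullet> acol A j \<le> \<omega>' $ j"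
        by (subst (asm) subset_cell_iff) blast
      show "\<tau> \<in> subdiv A (\<omega>' + t *\<^sub>R \<omega>)"
        using c c' t
        by (auto simp: subdiv_def inner_add_left intro!: exI[of _ "c' + t *\<^sub>R c"] add_le_less_mono)
    qed
  qed
  then have "eventually (\<lambda>t. \<omega>' + t *\<^sub>R \<omega> \<in> weight_cone A (subdiv A \<omega>)) (at_right (0::real))"
    by (auto simp: weight_cone_def eventually_at_filter)
  then have "eventually (\<lambda>t. \<omega>' + t *\<^sub>R \<omega> \<in> closure (weight_cone A (subdiv A \<omega>))) (at_right (0::real))"
    by (rule eventually_mono) (use closure_subset in blast)
  moreover have "((\<lambda>t. \<omega>' + t *\<^sub>R \<omega>) \<longlongrightarrow> \<omega>' + 0 *\<^sub>R \<omega>) (at_right (0::real))"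
    by (intro tendsto_intros)
  ultimately show ?thesis
    by (intro Lim_in_closed_set[of "closure _" "\<lambda>t. \<omega>' + t *\<^sub>R \<omega>" "at_right (0::real)"]) auto
qed

text \<open>For a simplex, lying in a cell is a system of weak linear inequalities in the weight,
  and these pass to limits.\<close>

lemma closure_imp_refines:
  fixes A :: "int^'n^'d"
  assumes simp: "\<And>\<sigma>. \<sigma> \<in> maximal_cells T \<Longrightarrow> simplex_of A \<sigma>"
    and cl: "\<omega> \<in> closure (weight_cone A T)"
  shows "subdiv_refines T (subdiv A \<omega>)"
  unfolding subdiv_refines_iff_maximal
proof
  fix \<sigma> assume \<sigma>: "\<sigma> \<in> maximal_cells T"
  let ?C = "{w. \<forall>j. (\<Sum>i\<in>\<sigma>. coord A \<sigma> (acol A j) i * w $ i) \<le> w $ j}"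
  have "w \<in> ?C" if "w \<in> weight_cone A T" for w
  proof -
    have "\<sigma> \<in> subdiv A w"
      using maximal_cellsD[OF \<sigma>] that by (simp add: weight_cone_def)
    then have "\<exists>\<tau>'\<in>subdiv A w. \<sigma> \<subseteq> \<tau>'" by blast
    then show ?thesis
      unfolding simplex_subset_cell_iff[OF simp[OF \<sigma>]] by (rule CollectI)
  qed
  moreover have "closed ?C"
    by (intro closed_Collect_all closed_Collect_le continuous_intros)
  ultimately have "closure (weight_cone A T) \<subseteq> ?C"
    by (intro closure_minimal subsetI)
  with cl have "\<omega> \<in> ?C" by (rule rev_subsetD)
  then show "\<exists>\<tau>'\<in>subdiv A \<omega>. \<sigma> \<subseteq> \<tau>'"
    unfolding simplex_subset_cell_iff[OF simp[OF \<sigma>]] by (rule CollectD)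
qed

lemma omega0_nth: "omega0 \<epsilon> $ j = 1 + (if j = last_index then \<epsilon> else 0)"
  by (simp add: omega0_def axis_def)

lemma sum_omega0:
  "(\<Sum>i\<in>\<sigma>. b i * omega0 \<epsilon> $ i) = (\<Sum>i\<in>\<sigma>. b i) + (if last_index \<in> \<sigma> then \<epsilon> * b last_index else 0)"
proof -
  have "(\<Sum>i\<in>\<sigma>. b i * omega0 \<epsilon> $ i) = (\<Sum>i\<in>\<sigma>. b i + (if i = last_index then \<epsilon> * b i else 0))"
    by (intro sum.cong) (auto simp: omega0_nth algebra_simps)
  then show ?thesis by (simp add: sum.distrib)
qed

section \<open>Points of \<open>U_triang\<close> with a vanishing coordinate\<close>

text \<open>For small \<open>s\<close> the monomial point \<open>y\<close> lies in every
  \<open>U_simplex\<close>. Setting its coordinate \<open>n\<close> to zero leaves the right-hand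
  sides unchanged, as \<open>n\<close> has no positive exponent there, and does not increase the
  left-hand sides.\<close>

lemma U_triang_vanishing_if_coord_nonpos:
  fixes A :: "int^'n^'d" and n :: 'n
  assumes simp: "\<And>\<sigma>. \<sigma> \<in> maximal_cells (subdiv A \<omega>) \<Longrightarrow> simplex_of A \<sigma>"
    and nonpos: "\<And>\<sigma> j. \<sigma> \<in> maximal_cells (subdiv A \<omega>) \<Longrightarrow> n \<in> \<sigma> \<Longrightarrow> j \<notin> \<sigma> \<Longrightarrow>
      (\<Sum>i\<in>\<sigma>. coord A \<sigma> (acol A j) i) = 1 \<Longrightarrow> coord A \<sigma> (acol A j) n \<le> 0"
    and R: "R > 0"
  shows "U_triang A (subdiv A \<omega>) R \<inter> {x. x $ n = 0} \<noteq> {}"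
proof -
  let ?M = "maximal_cells (subdiv A \<omega>)"
  \<comment> \<open>The slack of \<open>\<omega>\<close> in the simplex criterion; for
    \<open>y\<close> the inequality at \<open>j\<close> amounts to
    \<open>s powr g \<sigma> j < R\<close>.\<close>
  define g where "g \<sigma> j = \<omega> $ j - (\<Sum>i\<in>\<sigma>. coord A \<sigma> (acol A j) i * \<omega> $ i)" for \<sigma> j
  have g: "g \<sigma> j > 0" if "\<sigma> \<in> ?M" "j \<notin> \<sigma>" for \<sigma> j
    using simplex_cell_strict[OF simp[OF that(1)] maximal_cellsD[OF that(1)] that(2)]
    by (simp add: g_def)
  have "eventually (\<lambda>s. s powr g \<sigma> j < R) (at_right (0::real))" if "\<sigma> \<in> ?M" "j \<notin> \<sigma>" for \<sigma> j
  proof -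
    have "((\<lambda>s. s powr g \<sigma> j) \<longlongrightarrow> 0 powr g \<sigma> j) (at_right (0::real))"
      using g[OF that]
      by (intro tendsto_powr' tendsto_intros) (auto simp: eventually_at_filter)
    then show ?thesis using R by (intro order_tendstoD(2)) auto
  qed
  then have "eventually (\<lambda>s. \<forall>\<sigma>\<in>?M. \<forall>j\<in>- \<sigma>. s powr g \<sigma> j < R) (at_right (0::real))"
    by (intro eventually_ball_finite ballI) auto
  moreover have "eventually (\<lambda>s. s > 0) (at_right (0::real))"
    by (rule eventually_at_right_less)
  ultimately have "eventually (\<lambda>s. s > 0 \<and> (\<forall>\<sigma>\<in>?M. \<forall>j\<in>- \<sigma>. s powr g \<sigma> j < R)) (at_right (0::real))"
    by eventually_elim auto
  then have "\<exists>s>0. \<forall>\<sigma>\<in>?M. \<forall>j\<in>- \<sigma>. s powr g \<sigma> j < R"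
    by (rule eventually_happens'[rotated]) simp
  then obtain s :: real where s: "s > 0" "\<And>\<sigma> j. \<sigma> \<in> ?M \<Longrightarrow> j \<notin> \<sigma> \<Longrightarrow> s powr g \<sigma> j < R"
    by blast
  define y :: "complex^'n" where "y = (\<chi> j. complex_of_real (s powr \<omega> $ j))"
  define x :: "complex^'n" where "x = (\<chi> j. if j = n then 0 else y $ j)"
  have y: "norm (y $ j) = s powr \<omega> $ j" "y $ j \<noteq> 0" for j
    using s by (auto simp: y_def)
  have x: "x $ j = (if j = n then 0 else y $ j)" for j by (simp add: x_def)
  have "x \<in> U_simplex A \<sigma> R" if \<sigma>: "\<sigma> \<in> ?M" for \<sigma>
  proof -
    have yU: "y \<in> U_simplex A \<sigma> R"
    proof (subst U_simplex_nonvanishing, use y in simp, intro allI impI)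
      fix j assume "j \<notin> \<sigma> \<and> (\<Sum>i\<in>\<sigma>. coord A \<sigma> (acol A j) i) = 1"
      then have "s powr g \<sigma> j < R" using s \<sigma> by blast
      have "norm (y $ j) = s powr (g \<sigma> j) * s powr (\<Sum>i\<in>\<sigma>. coord A \<sigma> (acol A j) i * \<omega> $ i)"
        using s by (simp add: y g_def flip: powr_add)
      also have "\<dots> < R * s powr (\<Sum>i\<in>\<sigma>. coord A \<sigma> (acol A j) i * \<omega> $ i)"
        using \<open>s powr g \<sigma> j < R\<close> s by simp
      also have "s powr (\<Sum>i\<in>\<sigma>. coord A \<sigma> (acol A j) i * \<omega> $ i) =
          (\<Prod>i\<in>\<sigma>. norm (y $ i) powr coord A \<sigma> (acol A j) i)"
        using s by (simp add: y powr_sum powr_powr mult.commute)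
      finally show "norm (y $ j) < R * (\<Prod>i\<in>\<sigma>. norm (y $ i) powr coord A \<sigma> (acol A j) i)" .
    qed
    have "norm (x $ j) * (\<Prod>i | i \<in> \<sigma> \<and> b i < 0. norm (x $ i) powr (- b i))
        < R * (\<Prod>i | i \<in> \<sigma> \<and> b i > 0. norm (x $ i) powr b i)"
      if j: "j \<notin> \<sigma>" "(\<Sum>i\<in>\<sigma>. coord A \<sigma> (acol A j) i) = 1" and b: "b = coord A \<sigma> (acol A j)" for j b
    proof -
      have lt: "norm (y $ j) * (\<Prod>i | i \<in> \<sigma> \<and> b i < 0. norm (y $ i) powr (- b i))
        < R * (\<Prod>i | i \<in> \<sigma> \<and> b i > 0. norm (y $ i) powr b i)"
        using yU j unfolding U_simplex_def b by (auto simp: Let_def)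
      have "b n \<le> 0" if "n \<in> \<sigma>" using nonpos[OF \<sigma> that j] b by simp
      then have "(\<Prod>i | i \<in> \<sigma> \<and> b i > 0. norm (x $ i) powr b i) =
          (\<Prod>i | i \<in> \<sigma> \<and> b i > 0. norm (y $ i) powr b i)"
        by (intro prod.cong) (auto simp: x)
      moreover have "norm (x $ j) * (\<Prod>i | i \<in> \<sigma> \<and> b i < 0. norm (x $ i) powr (- b i))
          \<le> norm (y $ j) * (\<Prod>i | i \<in> \<sigma> \<and> b i < 0. norm (y $ i) powr (- b i))"
        by (intro mult_mono prod_mono prod_nonneg conjI powr_mono2) (auto simp: x)
      ultimately show ?thesis using lt by simp
    qed
    then show ?thesis by (auto simp: U_simplex_def Let_def)
  qed
  then have "x \<in> U_triang A (subdiv A \<omega>) R \<inter> {x. x $ n = 0}"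
    by (auto simp: U_triang_def x)
  then show ?thesis by blast
qed

text \<open>A positive exponent at \<open>n\<close> would make the right-hand side zero, yet it
  strictly exceeds a non-negative number.\<close>

lemma coord_nonpos_if_U_simplex_vanishing:
  fixes A :: "int^'n^'d"
  assumes x: "x \<in> U_simplex A \<sigma> R" "x $ n = 0" and n: "n \<in> \<sigma>"
    and j: "j \<notin> \<sigma>" "(\<Sum>i\<in>\<sigma>. coord A \<sigma> (acol A j) i) = 1"
  shows "coord A \<sigma> (acol A j) n \<le> 0"
proof (rule ccontr)
  let ?b = "coord A \<sigma> (acol A j)"
  assume "\<not> ?b n \<le> 0"
  then have "(\<Prod>i | i \<in> \<sigma> \<and> ?b i > 0. norm (x $ i) powr ?b i) = 0"
    using n x(2) by (auto intro!: bexI[of _ n])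
  moreover have "norm (x $ j) * (\<Prod>i | i \<in> \<sigma> \<and> ?b i < 0. norm (x $ i) powr (- ?b i))
      < R * (\<Prod>i | i \<in> \<sigma> \<and> ?b i > 0. norm (x $ i) powr ?b i)"
    using x(1) j by (auto simp: U_simplex_def Let_def)
  moreover have "norm (x $ j) * (\<Prod>i | i \<in> \<sigma> \<and> ?b i < 0. norm (x $ i) powr (- ?b i)) \<ge> 0"
    by (intro mult_nonneg_nonneg prod_nonneg) auto
  ultimately show False by (simp only: mult_zero_right)
qed

section \<open>Refinement of the perturbed subdivision\<close>

text \<open>As \<open>j \<noteq> last_index\<close>, the simplex criterion for
  \<open>omega0 \<epsilon>\<close> reads \<open>1 + \<epsilon> * b \<le> 1\<close>, with
  \<open>b\<close> the coordinate in question.\<close>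

lemma coord_nonpos_if_refines_omega0:
  fixes A :: "int^('n::{finite,linorder})^'d"
  assumes ref: "subdiv_refines T (subdiv A (omega0 \<epsilon>))" and \<epsilon>: "\<epsilon> > 0"
    and \<sigma>: "\<sigma> \<in> T" "simplex_of A \<sigma>" and n: "last_index \<in> \<sigma>"
    and j: "j \<notin> \<sigma>" "(\<Sum>i\<in>\<sigma>. coord A \<sigma> (acol A j) i) = 1"
  shows "coord A \<sigma> (acol A j) last_index \<le> 0"
proof -
  have "\<exists>\<tau>'\<in>subdiv A (omega0 \<epsilon>). \<sigma> \<subseteq> \<tau>'" using ref \<sigma> by (simp add: subdiv_refines_def)
  then have "(\<Sum>i\<in>\<sigma>. coord A \<sigma> (acol A j) i * omega0 \<epsilon> $ i) \<le> omega0 \<epsilon> $ j"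
    using simplex_subset_cell_iff[OF \<sigma>(2)] by blast
  moreover have "j \<noteq> last_index" using n j by auto
  ultimately have "\<epsilon> * coord A \<sigma> (acol A j) last_index \<le> 0"
    using n j unfolding sum_omega0 by (simp add: omega0_nth)
  with \<epsilon> show ?thesis by (simp add: mult_le_0_iff)
qed

text \<open>Refining \<open>Gamma_subdiv A\<close> bounds each coordinate sum by 1. A sum below 1
  leaves room for a small perturbation; at sum 1 the sign of the last coordinate decides. There are
  finitely many inequalities, so they hold together for small \<open>\<epsilon>\<close>.\<close>

lemma eventually_refines_omega0:
  fixes A :: "int^('n::{finite,linorder})^'d"
  assumes simp: "\<And>\<sigma>. \<sigma> \<in> maximal_cells T \<Longrightarrow> simplex_of A \<sigma>"
    and Gamma: "subdiv_refines T (Gamma_subdiv A)"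
    and nonpos: "\<And>\<sigma> j. \<sigma> \<in> maximal_cells T \<Longrightarrow> last_index \<in> \<sigma> \<Longrightarrow> j \<notin> \<sigma> \<Longrightarrow>
      (\<Sum>i\<in>\<sigma>. coord A \<sigma> (acol A j) i) = 1 \<Longrightarrow> coord A \<sigma> (acol A j) last_index \<le> 0"
  shows "eventually (\<lambda>\<epsilon>. subdiv_refines T (subdiv A (omega0 \<epsilon>))) (at_right 0)"
proof -
  have "eventually (\<lambda>\<epsilon>. (\<Sum>i\<in>\<sigma>. coord A \<sigma> (acol A j) i * omega0 \<epsilon> $ i) \<le> omega0 \<epsilon> $ j) (at_right 0)"
    if \<sigma>: "\<sigma> \<in> maximal_cells T" for \<sigma> j
  proof -
    let ?b = "coord A \<sigma> (acol A j)"
    have pos: "eventually (\<lambda>\<epsilon>. \<epsilon> > 0) (at_right (0::real))"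
      by (rule eventually_at_right_less)
    have "\<exists>\<tau>'\<in>subdiv A (\<chi> j. 1). \<sigma> \<subseteq> \<tau>'"
      using Gamma maximal_cellsD[OF \<sigma>] by (simp add: subdiv_refines_def Gamma_subdiv_def)
    then have le1: "sum ?b \<sigma> \<le> 1"
      using simplex_subset_cell_iff[OF simp[OF \<sigma>], of "\<chi> j. 1"] by auto
    \<comment> \<open>Only the last case restricts \<open>\<epsilon>\<close>; in the others the
      inequality holds for every positive value.\<close>
    consider "j \<in> \<sigma>" | "j \<notin> \<sigma>" "last_index \<notin> \<sigma>" | "j \<notin> \<sigma>" "last_index \<in> \<sigma>" "sum ?b \<sigma> = 1"
      | "sum ?b \<sigma> < 1" "j \<notin> \<sigma>" "last_index \<in> \<sigma>"
      using le1 by linarith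
    then show ?thesis
    proof cases
      case 1
      then show ?thesis using coord_self[OF simp[OF \<sigma>], of j "\<lambda>i. omega0 _ $ i"] by simp
    next
      case 2
      then show ?thesis using le1 unfolding sum_omega0
        by (intro eventually_mono[OF pos]) (auto simp: omega0_nth)
    next
      case 3
      then have "j \<noteq> last_index" "?b last_index \<le> 0" using nonpos[OF \<sigma>] by auto
      with 3 show ?thesis unfolding sum_omega0
        by (intro eventually_mono[OF pos]) (auto simp: omega0_nth mult_le_0_iff)
    next
      case 4
      have "((\<lambda>\<epsilon>. sum ?b \<sigma> + \<epsilon> * ?b last_index) \<longlongrightarrow> sum ?b \<sigma> + 0 * ?b last_index) (at_right 0)"
        by (intro tendsto_intros)
      then have "eventually (\<lambda>\<epsilon>. sum ?b \<sigma> + \<epsilon> * ?b last_index < 1) (at_right 0)"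
        using 4 by (intro order_tendstoD(2)) auto
      with pos show ?thesis unfolding sum_omega0
        by eventually_elim (use 4 in \<open>auto simp: omega0_nth\<close>)
    qed
  qed
  then have "eventually (\<lambda>\<epsilon>. \<forall>\<sigma>\<in>maximal_cells T. \<forall>j\<in>UNIV.
      (\<Sum>i\<in>\<sigma>. coord A \<sigma> (acol A j) i * omega0 \<epsilon> $ i) \<le> omega0 \<epsilon> $ j) (at_right 0)"
    by (intro eventually_ball_finite ballI) auto
  then show ?thesis
    by (rule eventually_mono) (auto simp: subdiv_refines_iff_maximal simplex_subset_cell_iff simp)
qed

section \<open>Equivalence of the four conditions\<close>

theorem lemma2p7:
  fixes A :: "int^('n::{finite,linorder})^'d" and T :: "'n set set" and \<epsilon> :: real
  assumes "range (\<lambda>z :: int^('n::{finite,linorder}). \<Sum>j\<in>UNIV. z $ j *s column j A) = UNIV"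
    and "regular_triangulation A T"
    and "subdiv_refines T (Gamma_subdiv A)"
    and "\<epsilon> > 0"
    and "\<forall>\<epsilon>'. 0 < \<epsilon>' \<and> \<epsilon>' < \<epsilon> \<longrightarrow> subdiv A (omega0 \<epsilon>') = subdiv A (omega0 \<epsilon>)"
  shows "(omega0 \<epsilon> \<in> closure (weight_cone A T) \<longleftrightarrow> subdiv_refines T (subdiv A (omega0 \<epsilon>))) \<and>
    (subdiv_refines T (subdiv A (omega0 \<epsilon>)) \<longleftrightarrow>
      (\<forall>R>0. U_triang A T R \<inter> {x. x $ last_index = 0} \<noteq> {})) \<and>
    ((\<forall>R>0. U_triang A T R \<inter> {x. x $ last_index = 0} \<noteq> {}) \<longleftrightarrow>
      (\<exists>R>0. U_triang A T R \<inter> {x. x $ last_index = 0} \<noteq> {}))"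
proof -
  obtain \<omega> where w: "weight_vector A \<omega>" and T: "T = subdiv A \<omega>" and sc: "simplicial_complex T"
    using assms(2) by (auto simp: regular_triangulation_def)
  have simp: "simplex_of A \<sigma>" if "\<sigma> \<in> maximal_cells T" for \<sigma>
    using maximal_cell_simplex span_columns[OF assms(1)] sc that unfolding T by blast
  have 1: "omega0 \<epsilon> \<in> closure (weight_cone A T) \<longleftrightarrow> subdiv_refines T (subdiv A (omega0 \<epsilon>))"
    using closure_imp_refines[of T A] simp refines_imp_closure w sc unfolding T by blast
  have 2: "U_triang A T R \<inter> {x. x $ last_index = 0} \<noteq> {}"
    if "subdiv_refines T (subdiv A (omega0 \<epsilon>))" "R > 0" for R
    unfolding T
  proof (rule U_triang_vanishing_if_coord_nonpos)
    fix \<sigma> j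
    assume "\<sigma> \<in> maximal_cells (subdiv A \<omega>)" "last_index \<in> \<sigma>" "j \<notin> \<sigma>"
      "(\<Sum>i\<in>\<sigma>. coord A \<sigma> (acol A j) i) = 1"
    then show "coord A \<sigma> (acol A j) last_index \<le> 0"
      using coord_nonpos_if_refines_omega0[OF that(1) assms(4)] simp maximal_cellsD
      unfolding T by blast
  qed (use simp T that in auto)
  have 3: "subdiv_refines T (subdiv A (omega0 \<epsilon>))"
    if ne: "U_triang A T R \<inter> {x. x $ last_index = 0} \<noteq> {}" for R
  proof -
    obtain x where x: "x \<in> U_triang A T R" "x $ last_index = 0" using ne by blast
    have "x \<in> U_simplex A \<sigma> R" if "\<sigma> \<in> maximal_cells T" for \<sigma>
      using x(1) that by (simp add: U_triang_def)
    then have "eventually (\<lambda>\<epsilon>. subdiv_refines T (subdiv A (omega0 \<epsilon>))) (at_right 0)"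
      by (intro eventually_refines_omega0[OF simp assms(3)]
        coord_nonpos_if_U_simplex_vanishing[OF _ x(2)])
    \<comment> \<open>Refinement is known only for small parameters; constancy of the subdivision on
      the interval below \<open>\<epsilon>\<close> carries it to \<open>\<epsilon>\<close> itself.
      The resulting statement is constant in \<open>\<epsilon>'\<close>, and
      \<open>at_right 0\<close> is a nontrivial filter.\<close>
    moreover have "eventually (\<lambda>\<epsilon>'. \<epsilon>' \<in> {0<..<\<epsilon>}) (at_right 0)"
      using assms(4) by (rule eventually_at_right_real)
    ultimately have "eventually (\<lambda>\<epsilon>'. subdiv_refines T (subdiv A (omega0 \<epsilon>))) (at_right (0::real))"
      by eventually_elim (use assms(5) in auto)
    then show ?thesis by simp
  qed
  \<comment> \<open>\<open>2\<close> leads from (ii) to (iii), the choice \<open>R = 1\<close> from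
    (iii) to (iv), and \<open>3\<close> from (iv) back to (ii).\<close>
  show ?thesis using 1 2 3 zero_less_one by blast
qed

end
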